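(* Let $p$ be a prime and let $G$ be a finite $p$-group that is favorable, i.e. there is a non-identity automorphism $\phi$ of $G$ of order coprime to $p$ such that for every proper subgroup $H$ of $G$ with $\phi(H)=H$ one has $\phi(h)=h$ for all $h\in H$. Then $G$ is a special $p$-group; that is, either $G$ is elementary abelian, or $G'=\mathcal{Z}(G)=\Phi(G)$ and this subgroup is elementary abelian.
   Context: All groups are finite. For a group $G$, $G'$ denotes the commutator subgroup, $\mathcal{Z}(G)$ the center and $\Phi(G)$ the Frattini subgroup. A $p'$-automorphism of a $p$-group is an automorphism whose order is coprime to $p$. A $p$-group $G$ is called favorable if there is a non-identity $p'$-automorphism $\phi$ of $G$ such that, whenever $\phi$ fixes (setwise) a proper subgroup $H$ of $G$, it restricts to the identity on $H$. The term special $p$-group here covers two classes together: the elementary abelian $p$-groups, and the $p$-groups $G$ with $G'=\mathcal{Z}(G)=\Phi(G)$ elementary abelian. *)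

theory Defs
  imports "HOL-Algebra.Algebra"
begin

text \<open>
  The commutator subgroup of \<open>G\<close> is \<open>derived G (carrier G)\<close>; automorphisms are the elements of
  \<open>auto G\<close>, the carrier of \<open>AutoGroup G\<close>.
\<close>

text \<open>The order being a power of \<open>p\<close> forces the carrier to be finite, since \<open>card\<close> of an infinite
  set is 0.\<close>

definition p_group :: "nat \<Rightarrow> ('a, 'b) monoid_scheme \<Rightarrow> bool" where
  "p_group p G \<longleftrightarrow> Factorial_Ring.prime p \<and> Group.group G \<and> (\<exists>n. order G = p ^ n)"

definition elementary_abelian :: "nat \<Rightarrow> ('a, 'b) monoid_scheme \<Rightarrow> bool" where
  "elementary_abelian p G \<longleftrightarrow>
     p_group p G \<and> comm_group G \<and> (\<forall>x\<in>carrier G. x [^]\<^bsub>G\<^esub> p = \<one>\<^bsub>G\<^esub>)"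

definition center :: "('a, 'b) monoid_scheme \<Rightarrow> 'a set" where
  "center G = {z \<in> carrier G. \<forall>g\<in>carrier G. z \<otimes>\<^bsub>G\<^esub> g = g \<otimes>\<^bsub>G\<^esub> z}"

definition maximal_subgroup :: "'a set \<Rightarrow> ('a, 'b) monoid_scheme \<Rightarrow> bool" where
  "maximal_subgroup M G \<longleftrightarrow>
     subgroup M G \<and> M \<noteq> carrier G \<and>
     (\<forall>H. subgroup H G \<and> M \<subseteq> H \<longrightarrow> H = M \<or> H = carrier G)"

text \<open>Intersecting with the carrier gives \<open>frattini G = carrier G\<close> when there is no maximal
  subgroup, i.e. when the finite group \<open>G\<close> is trivial.\<close>

definition frattini :: "('a, 'b) monoid_scheme \<Rightarrow> 'a set" where
  "frattini G = carrier G \<inter> \<Inter>{M. maximal_subgroup M G}"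

definition p'_automorphism :: "nat \<Rightarrow> ('a, 'b) monoid_scheme \<Rightarrow> ('a \<Rightarrow> 'a) \<Rightarrow> bool" where
  "p'_automorphism p G \<phi> \<longleftrightarrow> \<phi> \<in> auto G \<and> coprime (group.ord (AutoGroup G) \<phi>) p"

definition favorable :: "nat \<Rightarrow> ('a, 'b) monoid_scheme \<Rightarrow> bool" where
  "favorable p G \<longleftrightarrow>
     p_group p G \<and>
     (\<exists>\<phi>. p'_automorphism p G \<phi> \<and> \<phi> \<noteq> \<one>\<^bsub>AutoGroup G\<^esub> \<and>
        (\<forall>H. subgroup H G \<and> H \<noteq> carrier G \<and> \<phi> ` H = H \<longrightarrow> (\<forall>h\<in>H. \<phi> h = h)))"

definition special_p_group :: "nat \<Rightarrow> ('a, 'b) monoid_scheme \<Rightarrow> bool" where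
  "special_p_group p G \<longleftrightarrow>
     p_group p G \<and>
     (elementary_abelian p G \<or>
      derived G (carrier G) = center G \<and> center G = frattini G \<and>
      elementary_abelian p (G\<lparr>carrier := center G\<rparr>))"

end

theory Submission
  imports Defs
begin

text \<open>
  The fixed subgroup \<open>C\<close> of the favorable automorphism \<open>\<phi>\<close> is proper and contains every proper
  \<open>\<phi>\<close>-invariant subgroup. As \<open>\<phi>\<close> has order coprime to \<open>p\<close>, \<open>\<phi> x = d x\<close> with \<open>d\<close> in \<open>C\<close> forces
  \<open>d = 1\<close>; hence an invariant subgroup containing all \<open>\<phi> x x\<^sup>-\<^sup>1\<close> is the whole group. If \<open>G\<close> is not
  abelian, this applies to the centralizer of \<open>C\<close>, because \<open>G' \<le> C\<close>, so that \<open>C = Z(G)\<close>, and then to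
  \<open>{g \<phi> x x\<^sup>-\<^sup>1 | g \<in> G'}\<close>, which gives \<open>Z(G) \<le> G'\<close>. In class two, \<open>G' \<le> \<Phi>(G)\<close>, and \<open>\<Phi>(G) \<le> C\<close>
  because it is proper and characteristic.
\<close>

section \<open>Finite $p$-groups\<close>

text \<open>The factors are in the order used for the generators of \<open>derived\<close>, so
  commutators lie in \<open>derived\<close> by \<open>generate.incl\<close>.\<close>

abbreviation commutator :: "('a, 'b) monoid_scheme \<Rightarrow> 'a \<Rightarrow> 'a \<Rightarrow> 'a" where
  "commutator G x y \<equiv> x \<otimes>\<^bsub>G\<^esub> y \<otimes>\<^bsub>G\<^esub> inv\<^bsub>G\<^esub> x \<otimes>\<^bsub>G\<^esub> inv\<^bsub>G\<^esub> y"

section \<open>Subgroup criteria, center and commutators\<close>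

context group
begin

lemma inv_mult_cancel:
  assumes "x \<in> carrier G" "y \<in> carrier G"
  shows "inv x \<otimes> (x \<otimes> y) = y" and "x \<otimes> (inv x \<otimes> y) = y"
  using assms by (simp_all add: m_assoc[symmetric])

text \<open>In a finite group the inverse of a is the power of a with exponent
  \<open>ord a - 1\<close>, so closure under products gives closure under inverses.\<close>

lemma finite_subgroupI:
  assumes "finite (carrier G)" "H \<subseteq> carrier G" "\<one> \<in> H"
    and mult: "\<And>a b. a \<in> H \<Longrightarrow> b \<in> H \<Longrightarrow> a \<otimes> b \<in> H"
  shows "subgroup H G"
proof (rule subgroupI)
  fix a assume a: "a \<in> H"
  have aG: "a \<in> carrier G" using a assms(2) by blast
  have pow: "a [^] n \<in> H" for n :: nat
    by (induction n) (auto intro: mult a assms(3))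
  have "ord a > 0" using assms(1) aG ord_ge_1 by fastforce
  then obtain m where "ord a = Suc m" by (cases "ord a") auto
  then have "a [^] m \<otimes> a = \<one>"
    using pow_ord_eq_1[OF aG] by simp
  then have "inv a = a [^] m"
    using aG by (simp add: inv_equality)
  then show "inv a \<in> H" using pow by simp
qed (use assms in auto)

lemma center_commute: "z \<in> center G \<Longrightarrow> g \<in> carrier G \<Longrightarrow> z \<otimes> g = g \<otimes> z"
  by (simp add: center_def)

lemma center_carrier: "z \<in> center G \<Longrightarrow> z \<in> carrier G"
  by (simp add: center_def)

lemma center_subgroup: "subgroup (center G) G"
proof (rule subgroupI)
  fix a assume a: "a \<in> center G"
  have "inv a \<otimes> g = g \<otimes> inv a" if "g \<in> carrier G" for g
  proof -
    have aG: "a \<in> carrier G" using a by (rule center_carrier)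
    have "a \<otimes> g = g \<otimes> a" using a that by (rule center_commute)
    then have "inv a \<otimes> (a \<otimes> g) \<otimes> inv a = inv a \<otimes> (g \<otimes> a) \<otimes> inv a" by simp
    then show ?thesis
      using aG that by (simp add: m_assoc inv_mult_cancel)
  qed
  then show "inv a \<in> center G" using a by (simp add: center_def)
next
  fix a b assume ab: "a \<in> center G" "b \<in> center G"
  have "a \<otimes> b \<otimes> g = g \<otimes> (a \<otimes> b)" if g: "g \<in> carrier G" for g
  proof -
    have carr: "a \<in> carrier G" "b \<in> carrier G" using ab center_carrier by simp_all
    have "a \<otimes> b \<otimes> g = a \<otimes> (b \<otimes> g)" using carr g by (rule m_assoc)
    also have "b \<otimes> g = g \<otimes> b" using ab(2) g by (rule center_commute)
    also have "a \<otimes> (g \<otimes> b) = a \<otimes> g \<otimes> b" using carr g by (simp add: m_assoc)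
    also have "a \<otimes> g = g \<otimes> a" using ab(1) g by (rule center_commute)
    finally show ?thesis using carr g by (simp add: m_assoc)
  qed
  moreover have "a \<otimes> b \<in> carrier G" using ab center_carrier by simp
  ultimately show "a \<otimes> b \<in> center G" unfolding center_def by blast
next
  have "\<one> \<in> center G" by (simp add: center_def)
  then show "center G \<noteq> {}" by blast
qed (auto simp: center_def)

lemma center_eq_carrier_iff: "center G = carrier G \<longleftrightarrow> comm_group G"
proof
  assume "center G = carrier G"
  then show "comm_group G"
    by (intro group_comm_groupI) (auto simp: center_def)
next
  assume "comm_group G"
  then interpret comm_group G .
  show "center G = carrier G" by (auto simp: center_def m_comm)
qed

lemma commutator_in_derived:
  "x \<in> carrier G \<Longrightarrow> y \<in> carrier G \<Longrightarrow> commutator G x y \<in> derived G (carrier G)"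
  unfolding derived_def by (rule generate.incl) blast

lemma derived_subset_iff:
  assumes "subgroup H G"
  shows "derived G (carrier G) \<subseteq> H \<longleftrightarrow>
    (\<forall>x\<in>carrier G. \<forall>y\<in>carrier G. commutator G x y \<in> H)"
proof
  assume "\<forall>x\<in>carrier G. \<forall>y\<in>carrier G. commutator G x y \<in> H"
  then show "derived G (carrier G) \<subseteq> H"
    unfolding derived_def by (intro generate_subgroup_incl[OF _ assms]) auto
qed (use commutator_in_derived in blast)

lemma commutator_eq_one_iff:
  assumes "x \<in> carrier G" "y \<in> carrier G"
  shows "commutator G x y = \<one> \<longleftrightarrow> x \<otimes> y = y \<otimes> x"
  using assms by (metis inv_closed inv_solve_right l_one m_closed one_closed)

section \<open>Finite p-groups: nontrivial center and proper derived subgroup\<close>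

lemma p_group_finite:
  assumes "p_group p G"
  shows "finite (carrier G)"
  using assms order_gt_0_iff_finite by (auto simp: p_group_def prime_gt_0_nat)

lemma p_group_pow_eq_one:
  assumes "p_group p G"
  obtains n where "\<And>x. x \<in> carrier G \<Longrightarrow> x [^] (p ^ n) = \<one>"
  using assms pow_order_eq_1 by (metis p_group_def)

text \<open>The order of x divides both a power of p and m, hence is 1.\<close>

lemma p_group_coprime_pow_eq_one:
  assumes "p_group p G" "x \<in> carrier G" "coprime m p" "x [^] (m::nat) = \<one>"
  shows "x = \<one>"
proof -
  obtain n where "x [^] (p ^ n) = \<one>"
    using p_group_pow_eq_one assms(1,2) by metis
  then have "ord x dvd p ^ n" "ord x dvd m"
    using assms pow_eq_id by auto
  moreover have "coprime m (p ^ n)" using assms(3) by simp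
  ultimately have "ord x = 1" by (metis coprime_common_divisor_nat)
  then show ?thesis using assms(2) pow_ord_eq_1 nat_pow_eone by metis
qed

text \<open>Class equation: conjugacy classes have p-power size, and those of size 1 consist of
  central elements. If 1 were the only central element, the order of the group would be 1 modulo
  p.\<close>

lemma p_group_center_nontrivial:
  assumes "p_group p G" "carrier G \<noteq> {\<one>}"
  shows "center G \<noteq> {\<one>}"
proof
  assume trivial: "center G = {\<one>}"
  obtain n where p: "Factorial_Ring.prime p" and n: "order G = p ^ n"
    using assms(1) by (auto simp: p_group_def)
  have fin: "finite (carrier G)" using assms(1) by (rule p_group_finite)
  have "n \<noteq> 0"
    using n assms(2) order_one_triv_iff by auto
  define a where "a = (\<lambda>g. \<lambda>h\<in>carrier G. g \<otimes> h \<otimes> inv g)"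
  interpret a: group_action G "carrier G" a
    unfolding a_def by (rule action_by_conjugation)
  let ?Orbs = "orbits G (carrier G) a"
  have orbit_one: "orbit G a \<one> = {\<one>}"
    by (auto simp: orbit_def a_def intro!: exI[of _ \<one>])
  have "finite ?Orbs"
    using fin by (simp add: orbits_def setcompr_eq_image)
  moreover have "{\<one>} \<in> ?Orbs"
    using orbit_one by (auto simp: orbits_def)
  moreover have "sum card ?Orbs = p ^ n"
    using a.disjoint_sum[OF fin, of "\<lambda>_. 1::nat"] n by (simp add: order_def)
  moreover have "p dvd card Y" if "Y \<in> ?Orbs - {{\<one>}}" for Y
  proof -
    obtain x where x: "x \<in> carrier G" "Y = orbit G a x" "Y \<noteq> {\<one>}"
      using \<open>Y \<in> ?Orbs - {{\<one>}}\<close> by (auto simp: orbits_def)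
    have "card Y dvd p ^ n"
      using a.orbit_stabilizer_theorem[OF x(1)] n x(2) by (metis dvd_triv_left)
    then obtain i where i: "card Y = p ^ i"
      using p divides_primepow_nat by blast
    \<comment> \<open>A class of size 1 is {x} with x central, so x = 1, and {1} has been set
      aside.\<close>
    have "i \<noteq> 0"
    proof
      assume "i = 0"
      then obtain z where "Y = {z}" using i card_1_singletonE by auto
      moreover have "x \<in> Y" using a.orbit_refl x by simp
      ultimately have "Y = {x}" by simp
      have "x \<otimes> g = g \<otimes> x" if "g \<in> carrier G" for g
      proof -
        have "a g x \<in> Y" using that x(2) by (auto simp: orbit_def)
        then have "g \<otimes> x \<otimes> inv g = x"
          using x(1) \<open>Y = {x}\<close> by (simp add: a_def)
        then show ?thesis
          using that x(1) by (metis inv_closed inv_solve_right m_closed)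
      qed
      then have "x \<in> center G" using x(1) by (simp add: center_def)
      then show False using trivial \<open>Y = {x}\<close> x(3) by simp
    qed
    then show ?thesis by (simp add: i)
  qed
  ultimately have "p ^ n = 1 + sum card (?Orbs - {{\<one>}})"
    by (simp add: sum.remove)
  moreover have "p dvd sum card (?Orbs - {{\<one>}})"
    using \<open>\<And>Y. Y \<in> ?Orbs - {{\<one>}} \<Longrightarrow> p dvd card Y\<close> by (rule dvd_sum)
  moreover have "p dvd p ^ n" using \<open>n \<noteq> 0\<close> by simp
  ultimately have "p dvd 1" by (metis dvd_add_left_iff)
  then show False using p by simp
qed

lemma p_group_FactGroup:
  assumes "p_group p G" "N \<lhd> G"
  shows "p_group p (G Mod N)"
proof -
  obtain n where p: "Factorial_Ring.prime p" and n: "order G = p ^ n"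
    using assms(1) by (auto simp: p_group_def)
  have "order (G Mod N) dvd p ^ n"
    using lagrange[OF normal_imp_subgroup[OF assms(2)]] n
    by (metis FactGroup_def dvd_triv_left order_def partial_object.select_convs(1))
  then show ?thesis
    using p divides_primepow_nat normal.factorgroup_is_group[OF assms(2)]
    by (auto simp: p_group_def)
qed

text \<open>A maximal proper normal subgroup \<open>N\<close> contains \<open>G'\<close>: the preimage of \<open>Z(G/N) \<noteq> 1\<close> is a normal
  subgroup strictly above \<open>N\<close>, hence all of \<open>G\<close>.\<close>

lemma p_group_derived_proper:
  assumes "p_group p G" "carrier G \<noteq> {\<one>}"
  shows "derived G (carrier G) \<noteq> carrier G"
proof -
  have fin: "finite (carrier G)" using assms(1) by (rule p_group_finite)
  let ?A = "{N. N \<lhd> G \<and> N \<noteq> carrier G}"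
  have "?A \<subseteq> Pow (carrier G)"
    using normal_imp_subgroup subgroup.subset by blast
  then have "finite ?A" using fin by (meson finite_Pow_iff finite_subset)
  moreover have "{\<one>} \<in> ?A" using assms(2) one_is_normal by auto
  ultimately obtain N where N: "N \<in> ?A" and maxN: "\<forall>M\<in>?A. N \<subseteq> M \<longrightarrow> N = M"
    using finite_has_maximal[of ?A] by blast
  then interpret N: normal N G by simp
  let ?Q = "G Mod N"
  interpret Q: group ?Q by (rule N.factorgroup_is_group)
  interpret q: group_hom G ?Q "\<lambda>x. N #> x"
    by unfold_locales (rule N.r_coset_hom_Mod)
  have cos: "N #> x = \<one>\<^bsub>?Q\<^esub> \<longleftrightarrow> x \<in> N" if "x \<in> carrier G" for x
    using that N.one_closed N.subgroup_axioms
    by (metis one_FactGroup coset_join1 coset_join2 subgroup.subset)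
  define P where "P = {x \<in> carrier G. N #> x \<in> center ?Q}"
  have "P \<lhd> G"
  proof (rule normal_invI)
    interpret Z: subgroup "center ?Q" ?Q by (rule Q.center_subgroup)
    show "subgroup P G"
    proof (rule finite_subgroupI[OF fin])
      show "\<one> \<in> P" using Z.one_closed by (simp add: P_def del: one_FactGroup)
    qed (auto simp: P_def simp del: mult_FactGroup)
    fix x h assume "x \<in> carrier G" "h \<in> P"
    then have hG: "h \<in> carrier G"
      and comm: "(N #> x) \<otimes>\<^bsub>?Q\<^esub> (N #> h) = (N #> h) \<otimes>\<^bsub>?Q\<^esub> (N #> x)"
      using q.hom_closed unfolding P_def center_def by blast+
    have "N #> (x \<otimes> h \<otimes> inv x) = (N #> x) \<otimes>\<^bsub>?Q\<^esub> (N #> h) \<otimes>\<^bsub>?Q\<^esub> inv\<^bsub>?Q\<^esub> (N #> x)"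
      using \<open>x \<in> carrier G\<close> hG by (simp del: mult_FactGroup)
    also have "\<dots> = N #> h"
      unfolding comm using \<open>x \<in> carrier G\<close> hG
      by (simp add: Q.m_assoc del: mult_FactGroup one_FactGroup)
    finally have "N #> (x \<otimes> h \<otimes> inv x) = N #> h" .
    then show "x \<otimes> h \<otimes> inv x \<in> P"
      using \<open>x \<in> carrier G\<close> \<open>h \<in> P\<close> by (simp add: P_def)
  qed
  moreover have "N \<subseteq> P"
  proof
    fix x assume "x \<in> N"
    then have "x \<in> carrier G" "N #> x = \<one>\<^bsub>?Q\<^esub>" using cos by auto
    then show "x \<in> P"
      using subgroup.one_closed[OF Q.center_subgroup] unfolding P_def by simp
  qed
  moreover have "N \<noteq> P"
  proof -
    have "carrier ?Q \<noteq> {\<one>\<^bsub>?Q\<^esub>}"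
    proof
      assume "carrier ?Q = {\<one>\<^bsub>?Q\<^esub>}"
      then have "x \<in> N" if "x \<in> carrier G" for x
        using cos q.hom_closed that by (metis singletonD)
      then show False using N N.subset by blast
    qed
    then have "center ?Q \<noteq> {\<one>\<^bsub>?Q\<^esub>}"
      by (rule Q.p_group_center_nontrivial[OF p_group_FactGroup[OF assms(1) N.normal_axioms]])
    then obtain Y where "Y \<in> center ?Q" "Y \<noteq> \<one>\<^bsub>?Q\<^esub>"
      using subgroup.one_closed[OF Q.center_subgroup] by blast
    moreover from this obtain x where "x \<in> carrier G" "Y = N #> x"
      by (auto simp: center_def FactGroup_def RCOSETS_def)
    ultimately show ?thesis using cos unfolding P_def by blast
  qed
  ultimately have P: "P = carrier G" using maxN by blast
  \<comment> \<open>Every coset is now central in the quotient, so the quotient is abelian and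
    commutators become trivial in it.\<close>
  have "commutator G x y \<in> N" if "x \<in> carrier G" "y \<in> carrier G" for x y
  proof -
    have "(N #> x) \<otimes>\<^bsub>?Q\<^esub> (N #> y) = (N #> y) \<otimes>\<^bsub>?Q\<^esub> (N #> x)"
      using that P q.hom_closed unfolding P_def center_def by blast
    then have "N #> commutator G x y = \<one>\<^bsub>?Q\<^esub>"
      using that Q.commutator_eq_one_iff[of "N #> x" "N #> y"]
      by (simp del: mult_FactGroup one_FactGroup)
    then show ?thesis using that by (subst (asm) cos) simp_all
  qed
  then have "derived G (carrier G) \<subseteq> N"
    using derived_subset_iff N.subgroup_axioms by blast
  then show ?thesis using N N.subset by blast
qed

section \<open>Class two and the Frattini subgroup\<close>

text \<open>In [ab,y] = a [b,y] y a^-1 y^-1 the central factor [b,y] moves to the front and leaves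
  [a,y].\<close>

lemma commutator_hom:
  assumes "derived G (carrier G) \<subseteq> center G" "y \<in> carrier G"
  shows "(\<lambda>x. commutator G x y) \<in> hom G G"
proof (rule homI)
  fix a b assume ab: "a \<in> carrier G" "b \<in> carrier G"
  have central: "commutator G x y \<otimes> g = g \<otimes> commutator G x y"
    if "x \<in> carrier G" "g \<in> carrier G" for x g
    by (rule center_commute[OF subsetD[OF assms(1) commutator_in_derived[OF that(1) assms(2)]] that(2)])
  have "commutator G (a \<otimes> b) y = a \<otimes> commutator G b y \<otimes> (y \<otimes> inv a \<otimes> inv y)"
    using ab assms(2) by (simp add: m_assoc inv_mult_group inv_mult_cancel)
  also have "\<dots> = commutator G b y \<otimes> a \<otimes> (y \<otimes> inv a \<otimes> inv y)"
    unfolding central[OF ab(2,1)] ..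
  also have "\<dots> = commutator G b y \<otimes> commutator G a y"
    using ab assms(2) by (simp add: m_assoc)
  also have "\<dots> = commutator G a y \<otimes> commutator G b y"
    using ab assms(2) by (intro central) simp_all
  finally show "commutator G (a \<otimes> b) y = commutator G a y \<otimes> commutator G b y" .
qed (use assms in auto)

lemma inv_commutator:
  "x \<in> carrier G \<Longrightarrow> y \<in> carrier G \<Longrightarrow> inv (commutator G x y) = commutator G y x"
  by (simp add: inv_mult_group m_assoc)

text \<open>If \<open>M\<close> is maximal and does not contain \<open>Z(G)\<close>, then \<open>G = M Z(G)\<close> and \<open>G' = M' \<le> M\<close>.\<close>

lemma derived_subset_frattini:
  assumes "finite (carrier G)" and central: "derived G (carrier G) \<subseteq> center G"
  shows "derived G (carrier G) \<subseteq> frattini G"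
proof -
  have "derived G (carrier G) \<subseteq> M" if "maximal_subgroup M G" for M
  proof (cases "center G \<subseteq> M")
    case True
    then show ?thesis using central by blast
  next
    case False
    interpret M: subgroup M G using that by (simp add: maximal_subgroup_def)
    interpret Z: subgroup "center G" G by (rule center_subgroup)
    define H where "H = {m \<otimes> z | m z. m \<in> M \<and> z \<in> center G}"
    have HI: "m \<otimes> z \<in> H" if "m \<in> M" "z \<in> center G" for m z
      using that by (auto simp: H_def)
    have "subgroup H G"
    proof (rule finite_subgroupI)
      show "H \<subseteq> carrier G" using M.subset Z.subset by (auto simp: H_def)
      show "\<one> \<in> H" using HI[OF M.one_closed Z.one_closed] by simp
      fix a b assume "a \<in> H" "b \<in> H"
      then obtain m z n w where *: "m \<in> M" "z \<in> center G" "n \<in> M" "w \<in> center G"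
        "a = m \<otimes> z" "b = n \<otimes> w" unfolding H_def by blast
      have "a \<otimes> b = m \<otimes> (z \<otimes> n) \<otimes> w" using * by (simp add: m_assoc)
      also have "z \<otimes> n = n \<otimes> z" using * by (intro center_commute) auto
      also have "m \<otimes> (n \<otimes> z) \<otimes> w = (m \<otimes> n) \<otimes> (z \<otimes> w)"
        using * by (simp add: m_assoc)
      finally have "a \<otimes> b = (m \<otimes> n) \<otimes> (z \<otimes> w)" .
      then show "a \<otimes> b \<in> H" using * HI by simp
    qed fact
    moreover have "M \<subseteq> H"
      using HI[OF _ Z.one_closed] by auto
    moreover have "center G \<subseteq> H"
      using HI[OF M.one_closed] by auto
    ultimately have H: "H = carrier G"
      using that False unfolding maximal_subgroup_def by blast
    have absorb: "commutator G (m \<otimes> z) y = commutator G m y"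
      if "m \<in> M" "z \<in> center G" "y \<in> carrier G" for m z y
    proof -
      have "commutator G z y = \<one>"
        using that by (subst commutator_eq_one_iff) (auto intro: center_commute)
      then show ?thesis
        using hom_mult[OF commutator_hom[OF central that(3)], of m z] that by simp
    qed
    have "commutator G x y \<in> M" if xy: "x \<in> carrier G" "y \<in> carrier G" for x y
    proof -
      have "x \<in> H" "y \<in> H" using H xy by simp_all
      then obtain m z n w where *: "m \<in> M" "z \<in> center G" "n \<in> M" "w \<in> center G"
        "x = m \<otimes> z" "y = n \<otimes> w" unfolding H_def by blast
      have "commutator G x y = commutator G m y"
        unfolding *(5) by (rule absorb[OF *(1,2) xy(2)])
      also have "\<dots> = inv (commutator G y m)"
        using inv_commutator[OF xy(2) M.mem_carrier[OF *(1)]] ..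
      also have "commutator G y m = commutator G n m"
        unfolding *(6) by (rule absorb[OF *(3,4) M.mem_carrier[OF *(1)]])
      finally show ?thesis using *(1,3) by simp
    qed
    then show ?thesis
      using derived_subset_iff M.subgroup_axioms by blast
  qed
  then show ?thesis
    using derived_in_carrier[of "carrier G"] unfolding frattini_def by blast
qed

lemma frattini_subgroup: "subgroup (frattini G) G"
proof -
  have "subgroup (\<Inter>(insert (carrier G) {M. maximal_subgroup M G})) G"
  proof (rule subgroups_Inter)
    show "subgroup M G" if "M \<in> insert (carrier G) {M. maximal_subgroup M G}" for M
      using that subgroup_self unfolding maximal_subgroup_def by blast
  qed simp
  then show ?thesis by (simp add: frattini_def)
qed

text \<open>The proper subgroups form a finite family containing {1}; a maximal member of it
  contains the Frattini subgroup.\<close>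

lemma frattini_proper:
  assumes "finite (carrier G)" "carrier G \<noteq> {\<one>}"
  shows "frattini G \<noteq> carrier G"
proof -
  let ?A = "{H. subgroup H G \<and> H \<noteq> carrier G}"
  have "?A \<subseteq> Pow (carrier G)" using subgroup.subset by blast
  then have "finite ?A" using assms(1) by (meson finite_Pow_iff finite_subset)
  moreover have "{\<one>} \<in> ?A" using assms(2) triv_subgroup by auto
  ultimately obtain M where M: "M \<in> ?A" "\<forall>H\<in>?A. M \<subseteq> H \<longrightarrow> M = H"
    using finite_has_maximal[of ?A] by blast
  then have "maximal_subgroup M G" unfolding maximal_subgroup_def by blast
  then have "frattini G \<subseteq> M" by (auto simp: frattini_def)
  then show ?thesis using M subgroup.subset by blast
qed

section \<open>Invariance of characteristic subgroups\<close>

lemma derived_automorphism: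
  assumes "\<phi> \<in> auto G"
  shows "\<phi> ` derived G (carrier G) = derived G (carrier G)"
proof -
  interpret group_hom G G \<phi> using assms by unfold_locales (simp add: auto_def)
  have "\<phi> ` carrier G = carrier G" using assms by (simp add: auto_def Bij_def bij_betw_def)
  then show ?thesis using derived_img[of "carrier G"] by simp
qed

lemma center_automorphism:
  assumes "\<phi> \<in> auto G"
  shows "\<phi> ` center G \<subseteq> center G"
proof -
  interpret group_hom G G \<phi> using assms by unfold_locales (simp add: auto_def)
  have surj: "\<phi> ` carrier G = carrier G" using assms by (simp add: auto_def Bij_def bij_betw_def)
  have "\<phi> z \<otimes> g = g \<otimes> \<phi> z" if "z \<in> center G" "g \<in> carrier G" for z g
  proof -
    from that(2) surj obtain h where h: "h \<in> carrier G" "g = \<phi> h" by blast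
    have z: "z \<in> carrier G" using that(1) by (rule center_carrier)
    have "\<phi> z \<otimes> g = \<phi> (z \<otimes> h)" using z h by simp
    also have "z \<otimes> h = h \<otimes> z" using that(1) h(1) by (rule center_commute)
    also have "\<phi> (h \<otimes> z) = g \<otimes> \<phi> z" using z h by simp
    finally show ?thesis .
  qed
  moreover have "\<phi> z \<in> carrier G" if "z \<in> center G" for z
    using that center_carrier by simp
  ultimately show ?thesis unfolding center_def by blast
qed

text \<open>The preimage of a maximal subgroup M is maximal, so it contains every element of the
  Frattini subgroup, whose image therefore lies in M.\<close>

lemma frattini_automorphism:
  assumes "\<phi> \<in> auto G"
  shows "\<phi> ` frattini G \<subseteq> frattini G"
proof -
  interpret group_hom G G \<phi> using assms by unfold_locales (simp add: auto_def)
  have bij: "\<phi> ` carrier G = carrier G" "inj_on \<phi> (carrier G)"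
    using assms by (simp_all add: auto_def Bij_def bij_betw_def)
  have "maximal_subgroup {x \<in> carrier G. \<phi> x \<in> M} G" if M: "maximal_subgroup M G" for M
    unfolding maximal_subgroup_def
  proof (intro conjI allI impI)
    interpret M: subgroup M G using M by (simp add: maximal_subgroup_def)
    let ?N = "{x \<in> carrier G. \<phi> x \<in> M}"
    have img: "\<phi> ` ?N = M" using bij(1) M.subset by auto
    show "subgroup ?N G" by (rule subgroupI) (auto intro: exI[of _ \<one>])
    show "?N \<noteq> carrier G" using img bij(1) M by (auto simp: maximal_subgroup_def)
    fix H assume H: "subgroup H G \<and> ?N \<subseteq> H"
    then have "H \<subseteq> carrier G" using subgroup.subset by blast
    \<comment> \<open>The image of H lies above M, so it is M or the whole group; injectivity
      carries this back to H.\<close>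
    have "subgroup (\<phi> ` H) G" "M \<subseteq> \<phi> ` H"
      using H img subgroup_img_is_subgroup by blast+
    then have "\<phi> ` H = \<phi> ` ?N \<or> \<phi> ` H = \<phi> ` carrier G"
      using M bij(1) img unfolding maximal_subgroup_def by metis
    then show "H = ?N \<or> H = carrier G"
      using inj_on_image_eq_iff[OF bij(2) \<open>H \<subseteq> carrier G\<close>] by auto
  qed
  then show ?thesis unfolding frattini_def by fastforce
qed

end

section \<open>Favorable automorphisms\<close>

locale coprime_automorphism = group G for G (structure) +
  fixes p :: nat and \<phi>
  assumes p_group: "p_group p G"
    and automorphism: "\<phi> \<in> auto G"
    and coprime: "coprime (group.ord (AutoGroup G) \<phi>) p"
begin

sublocale aut: group_hom G G \<phi>
  using automorphism by unfold_locales (simp add: auto_def)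

lemma surj: "\<phi> ` carrier G = carrier G"
  and inj: "inj_on \<phi> (carrier G)"
  using automorphism by (simp_all add: auto_def Bij_def bij_betw_def)

lemma finite: "finite (carrier G)"
  using p_group by (rule p_group_finite)

lemma AutoGroup_mult_apply:
  assumes "f \<in> auto G" "g \<in> auto G" "x \<in> carrier G"
  shows "(f \<otimes>\<^bsub>AutoGroup G\<^esub> g) x = f (g x)"
  using assms by (simp add: AutoGroup_def BijGroup_def auto_def compose_def)

text \<open>Lets the order of \<phi> in \<open>AutoGroup G\<close> be used pointwise, as a statement
  about iterates.\<close>

lemma AutoGroup_pow_apply:
  "x \<in> carrier G \<Longrightarrow> (\<phi> [^]\<^bsub>AutoGroup G\<^esub> (n::nat)) x = (\<phi> ^^ n) x"
proof (induction n arbitrary: x)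
  case 0
  then show ?case by (simp add: AutoGroup_def BijGroup_def)
next
  case (Suc n)
  interpret A: group "AutoGroup G" by (rule AutoGroup)
  have "\<phi> \<in> carrier (AutoGroup G)"
    using automorphism by (simp add: AutoGroup_def)
  then have "\<phi> [^]\<^bsub>AutoGroup G\<^esub> n \<in> carrier (AutoGroup G)" by simp
  then have "\<phi> [^]\<^bsub>AutoGroup G\<^esub> n \<in> auto G" by (simp add: AutoGroup_def)
  \<comment> \<open>The power multiplies by \<phi> on the right, so \<phi> acts first and the
    induction hypothesis is used at \<open>\<phi> x\<close>.\<close>
  then have "(\<phi> [^]\<^bsub>AutoGroup G\<^esub> n \<otimes>\<^bsub>AutoGroup G\<^esub> \<phi>) x = (\<phi> [^]\<^bsub>AutoGroup G\<^esub> n) (\<phi> x)"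
    using automorphism Suc.prems by (intro AutoGroup_mult_apply)
  then show ?case
    using Suc by (simp add: funpow_swap1)
qed

text \<open>Iterating \<open>\<phi> x = d x\<close> with \<open>\<phi> d = d\<close> gives \<open>\<phi>\<^sup>n x = d\<^sup>n x\<close>, so the order of \<open>d\<close> divides that
  of \<open>\<phi>\<close>, which is coprime to \<open>p\<close>.\<close>

lemma fixed_translation_trivial:
  assumes x: "x \<in> carrier G" and d: "d \<in> carrier G" "\<phi> d = d" "\<phi> x = d \<otimes> x"
  shows "d = \<one>"
proof -
  have iterate: "(\<phi> ^^ n) x = d [^] n \<otimes> x" for n
  proof (induction n)
    case 0
    then show ?case using x by simp
  next
    case (Suc n)
    have "\<phi> (d [^] n) = d [^] n" using d by (simp add: aut.hom_nat_pow)
    then show ?case using Suc x d by (simp add: m_assoc)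
  qed
  let ?n = "group.ord (AutoGroup G) \<phi>"
  interpret A: group "AutoGroup G" by (rule AutoGroup)
  have "\<phi> [^]\<^bsub>AutoGroup G\<^esub> ?n = \<one>\<^bsub>AutoGroup G\<^esub>"
    using automorphism by (intro A.pow_ord_eq_1) (simp add: AutoGroup_def)
  then have "(\<phi> ^^ ?n) x = x"
    using x AutoGroup_pow_apply[of x ?n] by (simp add: AutoGroup_def BijGroup_def)
  then have "d [^] ?n = \<one>"
    using iterate[of ?n] x d(1) by simp
  then show ?thesis
    using p_group_coprime_pow_eq_one[OF p_group d(1) coprime] by simp
qed

text \<open>An injective self-map of a finite set is onto. Thus an inclusion suffices for the
  setwise invariance in the definition of favorable.\<close>

lemma image_eq_if_invariant:
  assumes "H \<subseteq> carrier G" "\<phi> ` H \<subseteq> H"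
  shows "\<phi> ` H = H"
  using assms finite inj by (meson endo_inj_surj finite_subset inj_on_subset)

end

section \<open>The fixed subgroup of a favorable automorphism\<close>

locale favorable_automorphism = coprime_automorphism +
  assumes nontrivial: "\<phi> \<noteq> \<one>\<^bsub>AutoGroup G\<^esub>"
    and trivial_on_proper: "\<And>H h. subgroup H G \<Longrightarrow> H \<noteq> carrier G \<Longrightarrow> \<phi> ` H = H \<Longrightarrow> h \<in> H \<Longrightarrow> \<phi> h = h"
begin

text \<open>The subgroup C of the outline above.\<close>

definition fixed where "fixed = {x \<in> carrier G. \<phi> x = x}"

lemma fixedD:
  assumes "x \<in> fixed"
  shows "x \<in> carrier G" and "\<phi> x = x"
  using assms by (simp_all add: fixed_def)

lemma fixed_subgroup: "subgroup fixed G"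
proof (rule finite_subgroupI)
qed (auto simp: fixed_def finite)

lemma fixed_proper: "fixed \<noteq> carrier G"
proof
  assume "fixed = carrier G"
  then have "\<phi> x = x" if "x \<in> carrier G" for x using that by (auto simp: fixed_def)
  \<comment> \<open>The unit of \<open>AutoGroup G\<close> is the identity restricted to the
    carrier, so agreement on the carrier needs extensionality to give equality.\<close>
  moreover have "\<phi> \<in> extensional (carrier G)"
    using automorphism by (simp add: auto_def Bij_def)
  ultimately have "\<phi> = (\<lambda>x\<in>carrier G. x)"
    by (auto simp: extensional_def)
  then show False using nontrivial by (simp add: AutoGroup_def BijGroup_def)
qed

lemma carrier_nontrivial: "carrier G \<noteq> {\<one>}"
  using fixed_proper by (auto simp: fixed_def)

lemma proper_invariant_fixed:
  assumes "subgroup H G" "\<phi> ` H \<subseteq> H" "H \<noteq> carrier G"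
  shows "H \<subseteq> fixed"
proof
  fix h assume "h \<in> H"
  moreover have "H \<subseteq> carrier G" using assms(1) by (rule subgroup.subset)
  ultimately show "h \<in> fixed"
    using trivial_on_proper[OF assms(1,3) image_eq_if_invariant] assms(2)
    by (auto simp: fixed_def)
qed

text \<open>If H were proper, \<phi> would fix every d = \<phi> x x^-1. As \<phi> x = d x,
  \<open>fixed_translation_trivial\<close> would give d = 1 for all x, and \<phi> would be the
  identity.\<close>

lemma invariant_eq_carrier:
  assumes "subgroup H G" "\<phi> ` H \<subseteq> H" "\<And>x. x \<in> carrier G \<Longrightarrow> \<phi> x \<otimes> inv x \<in> H"
  shows "H = carrier G"
proof (rule ccontr)
  assume "H \<noteq> carrier G"
  then have "H \<subseteq> fixed" using assms proper_invariant_fixed by blast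
  have "\<phi> x = x" if x: "x \<in> carrier G" for x
  proof -
    have "\<phi> (\<phi> x \<otimes> inv x) = \<phi> x \<otimes> inv x"
      using assms(3)[OF x] \<open>H \<subseteq> fixed\<close> by (auto simp: fixed_def)
    moreover have "\<phi> x = (\<phi> x \<otimes> inv x) \<otimes> x"
      using x by (simp add: m_assoc)
    ultimately have "\<phi> x \<otimes> inv x = \<one>"
      using fixed_translation_trivial[of x "\<phi> x \<otimes> inv x"] x by simp
    then show ?thesis
      using \<open>\<phi> x = (\<phi> x \<otimes> inv x) \<otimes> x\<close> x by simp
  qed
  then show False using fixed_proper by (auto simp: fixed_def)
qed

section \<open>The abelian case\<close>

text \<open>The elements killed by p form an invariant subgroup U. If \<phi> fixes U pointwise, then
  by induction it fixes x^p, so d = \<phi> x x^-1 lies in U, is fixed, and equals 1.\<close>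

lemma comm_group_exponent:
  assumes "comm_group G" "x \<in> carrier G"
  shows "x [^] p = \<one>"
proof -
  interpret comm_group G by fact
  define U where "U = {x \<in> carrier G. x [^] p = \<one>}"
  have "subgroup U G"
    by (rule finite_subgroupI) (auto simp: U_def finite pow_mult_distrib m_comm)
  moreover have "\<phi> ` U \<subseteq> U"
    by (auto simp: U_def simp flip: aut.hom_nat_pow)
  moreover have "U = carrier G" if U: "U \<subseteq> fixed"
  proof -
    have "\<phi> x = x" if "x \<in> carrier G" "x [^] (p ^ n) = \<one>" for n x
      using that
    proof (induction n arbitrary: x)
      case 0
      then show ?case by simp
    next
      case (Suc n)
      let ?d = "\<phi> x \<otimes> inv x"
      have "(x [^] p) [^] (p ^ n) = \<one>"
        using Suc.prems by (simp add: nat_pow_pow)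
      then have "\<phi> (x [^] p) = x [^] p"
        using Suc.IH Suc.prems by simp
      then have "?d [^] p = \<one>"
        using Suc.prems by (simp add: pow_mult_distrib m_comm nat_pow_inv aut.hom_nat_pow)
      then have "?d \<in> fixed" using U Suc.prems by (auto simp: U_def)
      then have "?d = \<one>"
        using fixed_translation_trivial[of x ?d] Suc.prems by (simp add: fixed_def m_assoc)
      then show ?case
        using Suc.prems by (metis aut.hom_closed inv_closed inv_equality inv_inv)
    qed
    \<comment> \<open>This contradicts \<open>fixed_proper\<close>, and the claim follows from the
      contradiction.\<close>
    then have "fixed = carrier G"
      using p_group_pow_eq_one[OF p_group] unfolding fixed_def by blast
    then show ?thesis using fixed_proper by simp
  qed
  ultimately have "U = carrier G"
    using proper_invariant_fixed by blast
  then show ?thesis using assms(2) by (auto simp: U_def)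
qed

section \<open>The fixed subgroup, the center and the derived subgroup\<close>

text \<open>G' is invariant, and it is proper because G is a nontrivial p-group.\<close>

lemma derived_fixed: "derived G (carrier G) \<subseteq> fixed"
  using proper_invariant_fixed derived_is_subgroup derived_automorphism[OF automorphism]
    p_group_derived_proper[OF p_group carrier_nontrivial] by blast

text \<open>The centralizer K of C is invariant. For c in C the commutator [c, x^-1] lies in G' and
  is thus fixed by \<phi>; this says that \<phi> x x^-1 commutes with c, so
  \<open>invariant_eq_carrier\<close> applies to K.\<close>

lemma fixed_central: "fixed \<subseteq> center G"
proof -
  define K where "K = {x \<in> carrier G. \<forall>c\<in>fixed. c \<otimes> x = x \<otimes> c}"
  have KI: "x \<in> K" if "x \<in> carrier G" "\<And>c. c \<in> fixed \<Longrightarrow> c \<otimes> x = x \<otimes> c" for x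
    using that by (simp add: K_def)
  have KD: "c \<otimes> x = x \<otimes> c" "x \<in> carrier G" if "x \<in> K" "c \<in> fixed" for x c
    using that by (simp_all add: K_def)
  have "K = carrier G"
  proof (rule invariant_eq_carrier)
    show "subgroup K G"
    proof (rule finite_subgroupI)
      fix a b assume ab: "a \<in> K" "b \<in> K"
      then have carr: "a \<in> carrier G" "b \<in> carrier G" by (simp_all add: K_def)
      show "a \<otimes> b \<in> K"
      proof (rule KI)
        fix c assume c: "c \<in> fixed"
        have "c \<otimes> (a \<otimes> b) = c \<otimes> a \<otimes> b" using c fixedD carr by (simp add: m_assoc)
        also have "c \<otimes> a = a \<otimes> c" using ab(1) c by (rule KD)
        also have "a \<otimes> c \<otimes> b = a \<otimes> (c \<otimes> b)" using c fixedD carr by (simp add: m_assoc)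
        also have "c \<otimes> b = b \<otimes> c" using ab(2) c by (rule KD)
        finally show "c \<otimes> (a \<otimes> b) = a \<otimes> b \<otimes> c" using c fixedD carr by (simp add: m_assoc)
      qed (simp add: carr)
    qed (auto simp: K_def finite fixed_def)
    show "\<phi> ` K \<subseteq> K"
    proof
      fix y assume "y \<in> \<phi> ` K"
      then obtain x where x: "x \<in> K" "y = \<phi> x" by blast
      then have xG: "x \<in> carrier G" by (simp add: K_def)
      show "y \<in> K"
      proof (rule KI)
        fix c assume c: "c \<in> fixed"
        have "c \<otimes> y = \<phi> (c \<otimes> x)" using c fixedD x(2) xG by simp
        also have "c \<otimes> x = x \<otimes> c" using x(1) c by (rule KD)
        also have "\<phi> (x \<otimes> c) = y \<otimes> c" using c fixedD x(2) xG by simp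
        finally show "c \<otimes> y = y \<otimes> c" .
      qed (simp add: x(2) xG)
    qed
    fix x assume x: "x \<in> carrier G"
    show "\<phi> x \<otimes> inv x \<in> K"
    proof (rule KI)
      fix c assume c: "c \<in> fixed"
      have cG: "c \<in> carrier G" using c by (rule fixedD)
      let ?d = "\<phi> x \<otimes> inv x"
      have "commutator G c (inv x) \<in> fixed"
        using derived_fixed commutator_in_derived[OF cG inv_closed[OF x]] by blast
      then have "\<phi> (commutator G c (inv x)) = commutator G c (inv x)" by (rule fixedD)
      then have "c \<otimes> inv (\<phi> x) \<otimes> inv c \<otimes> \<phi> x = c \<otimes> inv x \<otimes> inv c \<otimes> x"
        using cG x fixedD(2)[OF c] by simp
      \<comment> \<open>The outer factors are chosen so that the two sides collapse to c^-1 d c and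
        d, where d = \<phi> x x^-1.\<close>
      then have "\<phi> x \<otimes> inv c \<otimes> (c \<otimes> inv (\<phi> x) \<otimes> inv c \<otimes> \<phi> x) \<otimes> inv x \<otimes> c =
                 \<phi> x \<otimes> inv c \<otimes> (c \<otimes> inv x \<otimes> inv c \<otimes> x) \<otimes> inv x \<otimes> c"
        by simp
      then have "inv c \<otimes> (?d \<otimes> c) = ?d"
        using cG x by (simp add: m_assoc inv_mult_cancel)
      then have "c \<otimes> ?d = c \<otimes> (inv c \<otimes> (?d \<otimes> c))" by simp
      then show "c \<otimes> ?d = ?d \<otimes> c"
        using cG x by (simp add: inv_mult_cancel)
    qed (simp add: x)
  qed
  then show ?thesis
    using KD fixedD unfolding center_def by blast
qed

text \<open>The center is invariant and, for non-abelian G, proper; this gives the inclusion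
  opposite to \<open>fixed_central\<close>.\<close>

lemma noncommutative_center_eq_fixed:
  assumes "\<not> comm_group G"
  shows "center G = fixed"
  using proper_invariant_fixed[OF center_subgroup center_automorphism[OF automorphism]]
    fixed_central assms center_eq_carrier_iff by blast

text \<open>The set \<open>S\<close> in the proof is an invariant subgroup containing all \<open>\<phi> x x\<^sup>-\<^sup>1\<close>, so every central \<open>c\<close> has the
  form \<open>g \<phi> x x\<^sup>-\<^sup>1\<close> with \<open>g\<close> in \<open>G'\<close>. Then \<open>\<phi> x = (g\<^sup>-\<^sup>1 c) x\<close> is a translation by a fixed element,
  which must be trivial.\<close>

lemma fixed_subset_derived: "fixed \<subseteq> derived G (carrier G)"
proof
  let ?D = "derived G (carrier G)"
  interpret D: subgroup ?D G by (rule derived_is_subgroup) simp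
  interpret F: subgroup fixed G by (rule fixed_subgroup)
  have D_central: "g \<otimes> x = x \<otimes> g" if "g \<in> ?D" "x \<in> carrier G" for g x
    using that derived_fixed fixed_central by (intro center_commute) auto
  define S where "S = {g \<otimes> (\<phi> x \<otimes> inv x) | g x. g \<in> ?D \<and> x \<in> carrier G}"
  have SI: "g \<otimes> (\<phi> x \<otimes> inv x) \<in> S" if "g \<in> ?D" "x \<in> carrier G" for g x
    using that unfolding S_def by blast
  have SE: "\<exists>g x. g \<in> ?D \<and> x \<in> carrier G \<and> s = g \<otimes> (\<phi> x \<otimes> inv x)" if "s \<in> S" for s
    using that unfolding S_def by blast
  have "S = carrier G"
  proof (rule invariant_eq_carrier)
    show "subgroup S G"
    proof (rule finite_subgroupI[OF finite])
      show "S \<subseteq> carrier G" using SE by fastforce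
      show "\<one> \<in> S" using SI[OF D.one_closed one_closed] by simp
      fix a b assume "a \<in> S" "b \<in> S"
      then obtain g x h y where *: "g \<in> ?D" "x \<in> carrier G" "h \<in> ?D" "y \<in> carrier G"
        and a: "a = g \<otimes> (\<phi> x \<otimes> inv x)" and b: "b = h \<otimes> (\<phi> y \<otimes> inv y)"
        using SE by meson
      let ?dx = "\<phi> x \<otimes> inv x" and ?dy = "\<phi> y \<otimes> inv y"
      \<comment> \<open>Moving x^-1 to the right past \<open>?dy\<close> costs the factor k. Being
        central, k comes to the front, and what remains is the element belonging to xy.\<close>
      define k where "k = commutator G (inv x) ?dy"
      have k: "k \<in> ?D" unfolding k_def using * by (intro commutator_in_derived) auto
      then have kG: "k \<in> carrier G" by (rule D.mem_carrier)
      have "?dx \<otimes> ?dy = \<phi> x \<otimes> k \<otimes> ?dy \<otimes> inv x"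
        unfolding k_def using * by (simp add: m_assoc inv_mult_group inv_mult_cancel)
      also have "\<phi> x \<otimes> k = k \<otimes> \<phi> x"
        by (rule D_central[OF k, symmetric]) (simp add: *)
      also have "k \<otimes> \<phi> x \<otimes> ?dy \<otimes> inv x = k \<otimes> (\<phi> (x \<otimes> y) \<otimes> inv (x \<otimes> y))"
        using * kG by (simp add: m_assoc inv_mult_group)
      finally have "?dx \<otimes> ?dy = k \<otimes> (\<phi> (x \<otimes> y) \<otimes> inv (x \<otimes> y))" .
      moreover have "a \<otimes> b = g \<otimes> h \<otimes> (?dx \<otimes> ?dy)"
      proof -
        have "a \<otimes> b = g \<otimes> (?dx \<otimes> h) \<otimes> ?dy" unfolding a b using * by (simp add: m_assoc)
        also have "?dx \<otimes> h = h \<otimes> ?dx"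
          by (rule D_central[OF *(3), symmetric]) (simp add: *)
        finally show ?thesis using * by (simp add: m_assoc)
      qed
      ultimately have "a \<otimes> b = (g \<otimes> h \<otimes> k) \<otimes> (\<phi> (x \<otimes> y) \<otimes> inv (x \<otimes> y))"
        using *(1-4) kG by (simp add: m_assoc)
      then show "a \<otimes> b \<in> S"
        using SI[of "g \<otimes> h \<otimes> k" "x \<otimes> y"] * k by (simp only: D.m_closed m_closed)
    qed
    show "\<phi> ` S \<subseteq> S"
    proof
      fix s assume "s \<in> \<phi> ` S"
      then obtain g x where *: "g \<in> ?D" "x \<in> carrier G" "s = \<phi> (g \<otimes> (\<phi> x \<otimes> inv x))"
        using SE by blast
      moreover have "\<phi> g = g" using subsetD[OF derived_fixed *(1)] by (rule fixedD)
      ultimately have "s = g \<otimes> (\<phi> (\<phi> x) \<otimes> inv (\<phi> x))" by simp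
      then show "s \<in> S" using SI[OF *(1), of "\<phi> x"] *(2) by simp
    qed
    show "\<phi> x \<otimes> inv x \<in> S" if "x \<in> carrier G" for x
      using SI[OF D.one_closed that] that by simp
  qed
  fix c assume c: "c \<in> fixed"
  then obtain g x where *: "g \<in> ?D" "x \<in> carrier G" "c = g \<otimes> (\<phi> x \<otimes> inv x)"
    using SE \<open>S = carrier G\<close> F.mem_carrier by blast
  have "inv g \<otimes> c = \<phi> x \<otimes> inv x"
    unfolding *(3) using *(1,2) by (simp add: inv_mult_cancel)
  moreover have "inv g \<otimes> c \<in> fixed"
    using *(1) c derived_fixed by blast
  ultimately have "\<phi> (\<phi> x \<otimes> inv x) = \<phi> x \<otimes> inv x"
    using fixedD(2) by simp
  then have "\<phi> x \<otimes> inv x = \<one>"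
    using fixed_translation_trivial[of x "\<phi> x \<otimes> inv x"] *(2) by (simp add: m_assoc)
  then have "c = g" using *(1,3) by simp
  then show "c \<in> ?D" using *(1) by simp
qed

section \<open>Exponent of the derived subgroup\<close>

text \<open>For fixed \<open>y\<close> the map \<open>x \<mapsto> [x, y]\<close> is a homomorphism, so \<open>{x. \<forall>y. [x, y]\<^sup>p = 1}\<close> is an invariant
  subgroup. If it were proper it would be \<open>Z(G)\<close>; but then \<open>x\<^sup>p \<in> Z(G)\<close> would imply \<open>x \<in> Z(G)\<close>, and
  \<open>G\<close> would be abelian, being a \<open>p\<close>-group.\<close>

lemma commutator_pow_prime:
  assumes "x \<in> carrier G" "y \<in> carrier G"
  shows "commutator G x y [^] p = \<one>"
proof (cases "comm_group G")
  case True
  then interpret comm_group G .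
  have "commutator G x y = \<one>"
    using commutator_eq_one_iff[OF assms] m_comm[OF assms] by blast
  then show ?thesis by simp
next
  case False
  have central: "derived G (carrier G) \<subseteq> center G"
    using derived_fixed fixed_central by blast
  have mult: "commutator G (a \<otimes> b) z = commutator G a z \<otimes> commutator G b z"
    if "a \<in> carrier G" "b \<in> carrier G" "z \<in> carrier G" for a b z
    using hom_mult[OF commutator_hom[OF central that(3)] that(1,2)] .
  have pow: "commutator G (a [^] p) z = commutator G a z [^] p"
    if "a \<in> carrier G" "z \<in> carrier G" for a z
    using hom_nat_pow[OF commutator_hom[OF central that(2)] that(1)] by (simp add: is_group)
  define U where "U = {x \<in> carrier G. \<forall>y\<in>carrier G. commutator G x y [^] p = \<one>}"
  have UI: "x \<in> U" if "x \<in> carrier G" "\<And>y. y \<in> carrier G \<Longrightarrow> commutator G x y [^] p = \<one>" for x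
    using that by (simp add: U_def)
  have UD: "commutator G x y [^] p = \<one>" if "x \<in> U" "y \<in> carrier G" for x y
    using that by (simp add: U_def)
  have UG: "x \<in> carrier G" if "x \<in> U" for x
    using that by (simp add: U_def)
  have "subgroup U G"
  proof (rule finite_subgroupI[OF finite])
    fix a b assume ab: "a \<in> U" "b \<in> U"
    note carr = ab[THEN UG]
    show "a \<otimes> b \<in> U"
    proof (rule UI)
      fix y assume y: "y \<in> carrier G"
      have "commutator G a y \<in> center G"
        using central commutator_in_derived[OF carr(1) y] by blast
      then have "commutator G a y \<otimes> commutator G b y = commutator G b y \<otimes> commutator G a y"
        by (rule center_commute) (simp add: carr y)
      then have "(commutator G a y \<otimes> commutator G b y) [^] p = \<one>"
        using carr y UD[OF ab(1) y] UD[OF ab(2) y] by (subst pow_mult_distrib) simp_all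
      then show "commutator G (a \<otimes> b) y [^] p = \<one>"
        by (simp only: mult[OF carr y])
    qed (simp add: carr)
  qed (auto simp: U_def)
  moreover have "\<phi> ` U \<subseteq> U"
  proof
    fix a assume "a \<in> \<phi> ` U"
    then obtain x where x: "x \<in> U" "a = \<phi> x" by blast
    show "a \<in> U"
    proof (rule UI)
      fix y assume "y \<in> carrier G"
      then obtain z where z: "z \<in> carrier G" "y = \<phi> z" using surj by blast
      have "commutator G a y [^] p = \<phi> (commutator G x z [^] p)"
        unfolding x(2) z(2) using UG[OF x(1)] z(1) by (simp add: aut.hom_nat_pow)
      then show "commutator G a y [^] p = \<one>"
        using UD[OF x(1) z(1)] by simp
    qed (simp add: x(2) UG[OF x(1)])
  qed
  moreover have "\<not> U \<subseteq> center G"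
  proof
    assume "U \<subseteq> center G"
    \<comment> \<open>Induction on n, with the hypothesis used at x^p; it covers every x, because
      x^(p^n) = 1 is central for a suitable n.\<close>
    have "x \<in> center G" if "x \<in> carrier G" "x [^] (p ^ n) \<in> center G" for n x
      using that
    proof (induction n arbitrary: x)
      case 0
      then show ?case by simp
    next
      case (Suc n)
      have "(x [^] p) [^] (p ^ n) \<in> center G"
        using Suc.prems by (simp add: nat_pow_pow)
      then have xp: "x [^] p \<in> center G"
        using Suc.IH Suc.prems(1) by blast
      have "x \<in> U"
      proof (rule UI)
        fix y assume y: "y \<in> carrier G"
        have "commutator G (x [^] p) y = \<one>"
          using Suc.prems(1) y center_commute[OF xp y] by (subst commutator_eq_one_iff) simp_all
        then show "commutator G x y [^] p = \<one>"
          by (simp only: pow[OF Suc.prems(1) y])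
      qed (rule Suc.prems)
      then show ?case using \<open>U \<subseteq> center G\<close> by blast
    qed
    moreover obtain n where "\<And>x. x \<in> carrier G \<Longrightarrow> x [^] (p ^ n) = \<one>"
      using p_group_pow_eq_one[OF p_group] by blast
    ultimately have "carrier G \<subseteq> center G"
      using subgroup.one_closed[OF center_subgroup] by (metis subsetI)
    then show False
      using False center_eq_carrier_iff center_carrier by blast
  qed
  \<comment> \<open>A proper invariant U would lie in \<open>fixed\<close> and so in the center,
    which has just been excluded.\<close>
  ultimately have "U = carrier G"
    using proper_invariant_fixed fixed_central by blast
  then show ?thesis using assms UD by blast
qed

text \<open>Central elements killed by p form a subgroup since they commute. It contains all
  commutators, hence G'.\<close>

lemma derived_pow_prime:
  assumes "x \<in> derived G (carrier G)"
  shows "x [^] p = \<one>"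
proof -
  define E where "E = {z \<in> center G. z [^] p = \<one>}"
  interpret Z: subgroup "center G" G by (rule center_subgroup)
  have "subgroup E G"
  proof (rule finite_subgroupI[OF finite])
    fix a b assume "a \<in> E" "b \<in> E"
    then have ab: "a \<in> center G" "b \<in> center G" "a [^] p = \<one>" "b [^] p = \<one>"
      by (simp_all add: E_def)
    have "(a \<otimes> b) [^] p = \<one>"
      using ab(3,4) center_commute[OF ab(1)] ab(1,2)[THEN center_carrier]
      by (subst pow_mult_distrib) simp_all
    then show "a \<otimes> b \<in> E" using ab(1,2) by (simp add: E_def)
  qed (auto simp: E_def)
  moreover have "commutator G x y \<in> E" if "x \<in> carrier G" "y \<in> carrier G" for x y
    using commutator_pow_prime commutator_in_derived that derived_fixed fixed_central
    unfolding E_def by blast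
  ultimately have "derived G (carrier G) \<subseteq> E"
    using derived_subset_iff by blast
  then show ?thesis using assms by (auto simp: E_def)
qed

section \<open>The abelian and non-abelian cases combined\<close>

lemma special: "special_p_group p G"
proof (cases "comm_group G")
  case True
  then show ?thesis
    using p_group comm_group_exponent by (auto simp: special_p_group_def elementary_abelian_def)
next
  case False
  have fixed: "center G = fixed" by (rule noncommutative_center_eq_fixed[OF False])
  then have derived: "derived G (carrier G) = center G"
    using derived_fixed fixed_subset_derived by blast
  have "frattini G \<subseteq> center G"
    unfolding fixed
    by (rule proper_invariant_fixed[OF frattini_subgroup frattini_automorphism[OF automorphism]
          frattini_proper[OF finite carrier_nontrivial]])
  moreover have "center G \<subseteq> frattini G"
    using derived_subset_frattini[OF finite] derived by simp
  ultimately have frattini: "center G = frattini G" by blast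
  let ?Z = "G\<lparr>carrier := center G\<rparr>"
  have "group ?Z"
    by (rule subgroup_imp_group[OF center_subgroup])
  then have "comm_group ?Z"
    by (rule group.group_comm_groupI) (auto intro: center_commute center_carrier)
  moreover have "p_group p ?Z"
  proof -
    obtain n where p: "Factorial_Ring.prime p" and n: "order G = p ^ n"
      using p_group by (auto simp: p_group_def)
    have "order ?Z dvd p ^ n"
      using lagrange[OF center_subgroup] n by (simp add: order_def) (metis dvd_triv_right)
    then show ?thesis
      using p divides_primepow_nat \<open>group ?Z\<close> by (auto simp: p_group_def)
  qed
  \<comment> \<open>The center equals G', so the exponent bound for G' applies to it.\<close>
  moreover have "x [^]\<^bsub>?Z\<^esub> p = \<one>\<^bsub>?Z\<^esub>" if "x \<in> carrier ?Z" for x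
    using derived_pow_prime[of x] that derived by (simp flip: nat_pow_consistent)
  ultimately have "elementary_abelian p ?Z"
    by (simp add: elementary_abelian_def)
  then show ?thesis
    using p_group derived frattini by (simp add: special_p_group_def)
qed

end

theorem theorem4p6:
  fixes p :: nat and G :: "('a, 'b) monoid_scheme"
  assumes "Factorial_Ring.prime p"
    and "p_group p G"
    and "favorable p G"
  shows "special_p_group p G"
proof -
  obtain \<phi> where \<phi>: "p'_automorphism p G \<phi>" "\<phi> \<noteq> \<one>\<^bsub>AutoGroup G\<^esub>"
    and trivial: "\<forall>H. subgroup H G \<and> H \<noteq> carrier G \<and> \<phi> ` H = H \<longrightarrow> (\<forall>h\<in>H. \<phi> h = h)"
    using assms(3) unfolding favorable_def by (elim conjE exE)
  interpret group G using assms(2) by (simp add: p_group_def)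
  interpret favorable_automorphism G p \<phi>
  proof
    show "\<phi> \<in> auto G" "coprime (group.ord (AutoGroup G) \<phi>) p"
      using \<phi>(1) by (simp_all add: p'_automorphism_def)
    show "\<phi> h = h" if "subgroup H G" "H \<noteq> carrier G" "\<phi> ` H = H" "h \<in> H" for H h
      using trivial that by blast
  qed (fact assms(2) \<phi>(2))+
  show ?thesis by (rule special)
qed

end
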